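(* Let $k \in \mathbb{N}_0$ and let $G$ be a graph. Then $G \in F(\chi,k)$ if and only if the following three conditions hold: (1) $G$ has a unique dominating vertex $v$; (2) in every optimal (proper, minimum-color) coloring of $G-v$, each color class consists of at least two vertices; (3) $\Delta(G)=\chi(G)+k$.
   Context: All graphs are finite and simple. $\Delta(H)$ denotes the maximum degree, $\chi(H)$ the chromatic number of $H$. A vertex is dominating if it is adjacent to all other vertices. For $k\in\mathbb{N}_0$, $\varUpsilon_k$ is the class of graphs $G$ such that every induced subgraph $H$ of $G$ (including $G$ itself) satisfies $\Delta(H)\le \chi(H)+k-1$. $F(\chi,k)$ denotes the set of minimal forbidden induced subgraphs of $\varUpsilon_k$: $F\in F(\chi,k)$ iff $F\notin\varUpsilon_k$ and every proper induced subgraph of $F$ lies in $\varUpsilon_k$ (graphs considered up to isomorphism). *)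

theory Defs
  imports "Graph_Theory.Graph_Theory"
begin

text \<open>
  Finite simple graphs are the finite loop-free symmetric digraphs without parallel arcs,
  i.e. the locale predicate \<open>graph\<close>: an undirected edge \<open>uv\<close> is the pair of
  arcs \<open>u \<rightarrow> v\<close>, \<open>v \<rightarrow> u\<close>.  Hence the degree of a vertex is its out-degree.
\<close>

text \<open>Meaningful only for graphs with at least one vertex.\<close>
definition max_degree :: "('a, 'b) pre_digraph \<Rightarrow> nat" where
  "max_degree G = Max (out_degree G ` verts G)"

definition dominating_vertex :: "('a, 'b) pre_digraph \<Rightarrow> 'a \<Rightarrow> bool" where
  "dominating_vertex G v \<longleftrightarrow> v \<in> verts G \<and> (\<forall>u \<in> verts G - {v}. v \<rightarrow>\<^bsub>G\<^esub> u)"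

definition proper_coloring :: "('a, 'b) pre_digraph \<Rightarrow> nat \<Rightarrow> ('a \<Rightarrow> nat) \<Rightarrow> bool" where
  "proper_coloring G n c \<longleftrightarrow>
     (\<forall>u \<in> verts G. c u < n) \<and>
     (\<forall>u \<in> verts G. \<forall>w \<in> verts G. u \<rightarrow>\<^bsub>G\<^esub> w \<longrightarrow> c u \<noteq> c w)"

definition chromatic_number :: "('a, 'b) pre_digraph \<Rightarrow> nat" where
  "chromatic_number G = (LEAST n. \<exists>c. proper_coloring G n c)"

definition optimal_coloring :: "('a, 'b) pre_digraph \<Rightarrow> ('a \<Rightarrow> nat) \<Rightarrow> bool" where
  "optimal_coloring G c \<longleftrightarrow> proper_coloring G (chromatic_number G) c"

definition color_class :: "('a, 'b) pre_digraph \<Rightarrow> ('a \<Rightarrow> nat) \<Rightarrow> nat \<Rightarrow> 'a set" where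
  "color_class G c i = {u \<in> verts G. c u = i}"

text \<open>
  The graph without vertices is not counted among the induced subgraphs tested here: with maximum
  degree and chromatic number 0 it would violate the inequality for \<open>k = 0\<close>, and
  \<open>Upsilon 0\<close> would be empty.  The inequality is stated over the integers because of the \<open>- 1\<close>.
\<close>
definition Upsilon :: "nat \<Rightarrow> ('a, 'b) pre_digraph set" where
  "Upsilon k = {G. graph G \<and>
     (\<forall>H. induced_subgraph H G \<and> verts H \<noteq> {} \<longrightarrow>
        int (max_degree H) \<le> int (chromatic_number H) + int k - 1)}"

text \<open>
  The set contains every representative (over the given vertex and arc types) of each
  isomorphism class of minimal forbidden induced subgraphs.
\<close>
definition forbidden_chi :: "nat \<Rightarrow> ('a, 'b) pre_digraph set" where
  "forbidden_chi k = {F. graph F \<and> F \<notin> Upsilon k \<and>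
     (\<forall>H. induced_subgraph H F \<and> H \<noteq> F \<longrightarrow> H \<in> Upsilon k)}"

end

theory Submission
  imports Defs
begin

text \<open>
  A vertex of maximum degree together with its neighbours already violates the inequality, so a
  minimal forbidden graph has a dominating vertex \<open>v\<close>, and its maximum degree is its order minus
  one.  Deleting a vertex other than \<open>v\<close> then lowers the maximum degree by exactly one, so
  minimality forces the chromatic number to stay the same; and a vertex whose deletion lowers the
  chromatic number is the same thing as a singleton colour class of an optimal colouring.
  Conversely, if no vertex other than \<open>v\<close> is critical, deleting \<open>s\<close> vertices, not just \<open>v\<close>,
  lowers the chromatic number by at most \<open>s - 1\<close>, while the maximum degree drops by at least \<open>s\<close>;
  deleting only \<open>v\<close> lowers the maximum degree by at least two, as \<open>v\<close> is the only dominating vertex.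
\<close>

section \<open>Colourings and induced subgraphs\<close>

lemma proper_coloring_mono:
  assumes "induced_subgraph H G" and "proper_coloring G n c"
  shows "proper_coloring H n c"
proof -
  have "verts H \<subseteq> verts G" "arcs_ends H \<subseteq> arcs_ends G"
    using assms(1) by (auto simp: arcs_ends_conv induced_subgraph_def subgraph_def compatible_def)
  then show ?thesis
    using assms(2) unfolding proper_coloring_def by blast
qed

lemma chromatic_number_le: "proper_coloring G n c \<Longrightarrow> chromatic_number G \<le> n"
  unfolding chromatic_number_def by (rule Least_le) blast

lemma dominates_induce_subgraph_iff:
  "u \<rightarrow>\<^bsub>G \<restriction> A\<^esub> w \<longleftrightarrow> u \<in> A \<and> w \<in> A \<and> u \<rightarrow>\<^bsub>G\<^esub> w"
  by (auto simp: arcs_ends_conv)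

lemma induce_subgraph_induce_subgraph: "B \<subseteq> A \<Longrightarrow> (G \<restriction> A) \<restriction> B = G \<restriction> B"
  by (rule pre_digraph.equality) auto

text \<open>Compatibility makes a subgraph share \<open>tail\<close> and \<open>head\<close> with
  the ambient graph, so literal equality holds, not just isomorphism. This lets vertex sets replace
  subgraphs.\<close>

lemma induced_subgraph_eq_induce: "induced_subgraph H G \<Longrightarrow> H = G \<restriction> verts H"
  by (rule pre_digraph.equality) (auto simp: induced_subgraph_def subgraph_def compatible_def)

text \<open>Renaming the top colour \<open>n\<close> to the free colour \<open>i\<close> merges no
  two classes. If \<open>i = n\<close>, the top colour is itself absent and nothing changes.\<close>

lemma proper_coloring_drop_unused:
  assumes "proper_coloring G (Suc n) c" and "i \<le> n" and "\<forall>u\<in>verts G. c u \<noteq> i"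
  shows "proper_coloring G n (\<lambda>u. if c u = n then i else c u)"
  using assms unfolding proper_coloring_def by (auto simp: less_Suc_eq) metis

lemma dominating_vertex_induce:
  assumes "dominating_vertex G v" and "v \<in> A" and "A \<subseteq> verts G"
  shows "dominating_vertex (G \<restriction> A) v"
  using assms unfolding dominating_vertex_def by (auto simp: dominates_induce_subgraph_iff)

context wf_digraph
begin

lemma induce_subgraph_self: "G \<restriction> verts G = G"
  by (rule pre_digraph.equality) auto

lemma del_vert_eq_induce: "del_vert v = G \<restriction> (verts G - {v})"
  by (rule pre_digraph.equality) (auto simp: del_vert_simps)

lemma induced_subgraph_del_vert: "induced_subgraph (del_vert v) G"
  unfolding del_vert_eq_induce by (rule induced_induce) blast

end

section \<open>Chromatic number under vertex deletion\<close>

context graph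
begin

lemma graph_induce:
  assumes "A \<subseteq> verts G"
  shows "graph (G \<restriction> A)"
proof -
  have ind: "induced_subgraph (G \<restriction> A) G" using assms by (rule induced_induce)
  interpret A: digraph "G \<restriction> A" using ind by (rule digraphI_induced)
  show ?thesis using induced_graph_imp_symmetric[OF sym_arcs ind] by (rule A.graphI)
qed

lemma ex_optimal_coloring: "\<exists>c. optimal_coloring G c"
proof -
  \<comment> \<open>Giving all vertices different colours shows that the \<open>LEAST\<close> in
    \<open>chromatic_number\<close> is attained.\<close>
  obtain c where "bij_betw c (verts G) {0..<card (verts G)}"
    using ex_bij_betw_finite_nat[OF finite_verts] by blast
  then have "proper_coloring G (card (verts G)) c"
    unfolding proper_coloring_def bij_betw_def inj_on_def
    using adj_not_same by fastforce
  then have "\<exists>n c. proper_coloring G n c" by blast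
  then show ?thesis
    unfolding optimal_coloring_def chromatic_number_def by (rule LeastI_ex)
qed

lemma chromatic_number_mono:
  assumes "induced_subgraph H G"
  shows "chromatic_number H \<le> chromatic_number G"
  using ex_optimal_coloring assms
  unfolding optimal_coloring_def by (meson chromatic_number_le proper_coloring_mono)

lemma proper_coloring_insert:
  assumes "proper_coloring (del_vert v) n c"
  shows "proper_coloring G (Suc n) (c(v := n))"
  using assms adj_not_same
  unfolding proper_coloring_def del_vert_eq_induce
  by (auto simp: dominates_induce_subgraph_iff less_Suc_eq)

lemma graph_del_vert: "graph (del_vert v)"
  unfolding del_vert_eq_induce by (rule graph_induce) blast

lemma chromatic_number_le_del_vert: "chromatic_number G \<le> Suc (chromatic_number (del_vert v))"
  using graph.ex_optimal_coloring[OF graph_del_vert] proper_coloring_insert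
  unfolding optimal_coloring_def by (meson chromatic_number_le)

lemma chromatic_number_del_vert_le: "chromatic_number (del_vert v) \<le> chromatic_number G"
  by (rule chromatic_number_mono[OF induced_subgraph_del_vert])

text \<open>Putting the deleted vertices back one at a time costs at most one new colour
  each.\<close>

lemma chromatic_number_le_induce:
  assumes "A \<subseteq> verts G"
  shows "chromatic_number G \<le> chromatic_number (G \<restriction> A) + card (verts G - A)"
proof -
  \<comment> \<open>The induction is on the deleted set \<open>B\<close>; \<open>A\<close> must
    vary, since it grows as \<open>B\<close> shrinks.\<close>
  have "chromatic_number G \<le> chromatic_number (G \<restriction> A) + card B"
    if "finite B" "B = verts G - A" "A \<subseteq> verts G" for A B
    using that
  proof (induction B arbitrary: A rule: finite_induct)
    case (empty A)
    then have "A = verts G" by blast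
    then show ?case by (simp add: induce_subgraph_self)
  next
    case (insert v B A)
    let ?A = "insert v A"
    have v: "v \<in> verts G" "v \<notin> A" using insert by auto
    have B: "B = verts G - ?A" using insert by blast
    interpret A: graph "G \<restriction> ?A"
      using v insert by (intro graph_induce) blast
    have "A.del_vert v = G \<restriction> A"
      using v by (simp add: A.del_vert_eq_induce induce_subgraph_induce_subgraph subset_insertI)
    then have "chromatic_number (G \<restriction> ?A) \<le> Suc (chromatic_number (G \<restriction> A))"
      by (metis A.chromatic_number_le_del_vert)
    moreover have "chromatic_number G \<le> chromatic_number (G \<restriction> ?A) + card B"
      using insert.IH[of ?A] v insert.prems B by auto
    ultimately show ?case
      using insert.hyps by simp
  qed
  then show ?thesis using assms by simp
qed

text \<open>If deleting \<open>u\<close> saves a colour, giving \<open>u\<close> that colour alone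
  yields an optimal colouring with class {u}. Conversely, a class with at most one vertex can be
  removed by deleting at most one vertex, which frees a colour.\<close>

lemma color_classes_ge_2_iff:
  "(\<forall>c. optimal_coloring G c \<longrightarrow> (\<forall>i<chromatic_number G. 2 \<le> card (color_class G c i))) \<longleftrightarrow>
   (\<forall>u\<in>verts G. chromatic_number (del_vert u) = chromatic_number G)"
proof (intro iffI allI impI ballI)
  fix u
  assume big: "\<forall>c. optimal_coloring G c \<longrightarrow>
      (\<forall>i<chromatic_number G. 2 \<le> card (color_class G c i))"
    and u: "u \<in> verts G"
  show "chromatic_number (del_vert u) = chromatic_number G"
  proof (rule ccontr)
    assume "\<not> ?thesis"
    then have n: "chromatic_number G = Suc (chromatic_number (del_vert u))"
      using chromatic_number_le_del_vert[of u] chromatic_number_del_vert_le[of u] by simp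
    let ?n = "chromatic_number (del_vert u)"
    obtain c where c: "proper_coloring (del_vert u) ?n c"
      using graph.ex_optimal_coloring[OF graph_del_vert] unfolding optimal_coloring_def by blast
    have "optimal_coloring G (c(u := ?n))"
      using proper_coloring_insert[OF c] unfolding optimal_coloring_def n .
    moreover have "color_class G (c(u := ?n)) ?n = {u}"
      using c u unfolding color_class_def proper_coloring_def
      by (auto simp: del_vert_simps) (metis Diff_iff less_irrefl singletonD)
    ultimately show False using big n by force
  qed
next
  fix c i
  assume del: "\<forall>u\<in>verts G. chromatic_number (del_vert u) = chromatic_number G"
    and "optimal_coloring G c" and i: "i < chromatic_number G"
  then have c: "proper_coloring G (chromatic_number G) c" unfolding optimal_coloring_def by blast
  obtain n where n: "chromatic_number G = Suc n" using i by (cases "chromatic_number G") auto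
  have fin: "finite (color_class G c i)" unfolding color_class_def by simp
  show "2 \<le> card (color_class G c i)"
  proof (rule ccontr)
    assume "\<not> ?thesis"
    then have "card (color_class G c i) = 0 \<or> card (color_class G c i) = 1" by linarith
    \<comment> \<open>\<open>H\<close> is G itself for an empty class, and G without the only vertex
      of a singleton class. Either way colour \<open>i\<close> is free on \<open>H\<close> although
      \<open>H\<close> still needs all colours.\<close>
    then obtain H where H: "induced_subgraph H G" "chromatic_number H = chromatic_number G"
      "\<forall>u\<in>verts H. c u \<noteq> i"
    proof
      assume "card (color_class G c i) = 0"
      then have "\<forall>u\<in>verts G. c u \<noteq> i" using fin unfolding color_class_def by auto
      then show thesis using that induced_subgraph_refl by blast
    next
      assume "card (color_class G c i) = 1"
      then obtain u where u: "color_class G c i = {u}" by (auto simp: card_1_singleton_iff)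
      then have "u \<in> verts G" and "\<forall>w\<in>verts (del_vert u). c w \<noteq> i"
        unfolding color_class_def by (auto simp: del_vert_simps)
      then show thesis using that del induced_subgraph_del_vert by blast
    qed
    have "proper_coloring H (Suc n) c" using proper_coloring_mono[OF H(1) c] n by simp
    then have "chromatic_number H \<le> n"
      using chromatic_number_le[OF proper_coloring_drop_unused[OF _ _ H(3)]] i n by simp
    then show False using H(2) n by simp
  qed
qed

text \<open>No other vertex can share the colour of a dominating vertex, so deleting it frees that
  colour.\<close>

lemma chromatic_number_del_dominating:
  assumes "dominating_vertex G v"
  shows "chromatic_number G = Suc (chromatic_number (del_vert v))"
proof (rule antisym[OF chromatic_number_le_del_vert])
  obtain c where c: "proper_coloring G (chromatic_number G) c"
    using ex_optimal_coloring unfolding optimal_coloring_def by blast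
  have v: "v \<in> verts G" "c v < chromatic_number G"
    using assms c unfolding dominating_vertex_def proper_coloring_def by auto
  then obtain n where n: "chromatic_number G = Suc n" by (cases "chromatic_number G") auto
  have "\<forall>u\<in>verts (del_vert v). c u \<noteq> c v"
    using assms c v(1) unfolding dominating_vertex_def proper_coloring_def del_vert_simps
    by (metis Diff_iff)
  moreover have "proper_coloring (del_vert v) (Suc n) c"
    using proper_coloring_mono[OF induced_subgraph_del_vert c] n by simp
  ultimately have "chromatic_number (del_vert v) \<le> n"
    using chromatic_number_le[OF proper_coloring_drop_unused[of "del_vert v" n c "c v"]] v n by simp
  then show "Suc (chromatic_number (del_vert v)) \<le> chromatic_number G" using n by simp
qed

section \<open>Degrees and dominating vertices\<close>

lemma out_degree_eq_card: "out_degree G v = card {u. v \<rightarrow>\<^bsub>G\<^esub> u}"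
proof -
  have "inj_on (head G) (out_arcs G v)"
    by (rule inj_onI) (auto intro!: no_multi_arcs simp: arc_to_ends_def)
  moreover have "head G ` out_arcs G v = {u. v \<rightarrow>\<^bsub>G\<^esub> u}"
    by (auto simp: arcs_ends_conv)
  ultimately show ?thesis unfolding out_degree_def by (metis card_image)
qed

lemma neighbours_subset: "{u. v \<rightarrow>\<^bsub>G\<^esub> u} \<subseteq> verts G - {v}"
  using adj_not_same adj_in_verts by blast

lemma out_degree_le:
  assumes "v \<in> verts G"
  shows "out_degree G v \<le> card (verts G) - 1"
  using card_mono[OF _ neighbours_subset[of v]] assms by (simp add: out_degree_eq_card)

text \<open>The neighbourhood lies in the finite set of the other vertices, so it fills that set as
  soon as the cardinalities agree.\<close>

lemma dominating_vertex_iff: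
  "dominating_vertex G v \<longleftrightarrow> v \<in> verts G \<and> out_degree G v = card (verts G) - 1"
proof (cases "v \<in> verts G")
  case True
  have "dominating_vertex G v \<longleftrightarrow> {u. v \<rightarrow>\<^bsub>G\<^esub> u} = verts G - {v}"
    using True neighbours_subset[of v] unfolding dominating_vertex_def by blast
  also have "\<dots> \<longleftrightarrow> card {u. v \<rightarrow>\<^bsub>G\<^esub> u} = card (verts G - {v})"
    using card_subset_eq[OF finite_Diff[OF finite_verts] neighbours_subset[of v]] by metis
  finally show ?thesis using True by (simp add: out_degree_eq_card)
qed (simp add: dominating_vertex_def)

lemma ex_max_degree:
  assumes "verts G \<noteq> {}"
  shows "\<exists>v\<in>verts G. out_degree G v = max_degree G"
proof -
  have "max_degree G \<in> out_degree G ` verts G"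
    unfolding max_degree_def using assms by (intro Max_in) auto
  then show ?thesis by (metis imageE)
qed

lemma out_degree_le_max_degree: "v \<in> verts G \<Longrightarrow> out_degree G v \<le> max_degree G"
  unfolding max_degree_def by simp

lemma max_degree_le:
  assumes "verts G \<noteq> {}"
  shows "max_degree G \<le> card (verts G) - 1"
  using ex_max_degree[OF assms] out_degree_le by metis

lemma max_degree_dominating:
  assumes "dominating_vertex G v"
  shows "max_degree G = card (verts G) - 1"
proof -
  have "v \<in> verts G" "out_degree G v = card (verts G) - 1"
    using assms dominating_vertex_iff by auto
  then show ?thesis
    using out_degree_le_max_degree max_degree_le by (metis antisym empty_iff)
qed

text \<open>The strictness supplies the second unit of degree lost when only the unique dominating
  vertex is deleted.\<close>

lemma max_degree_not_dominating:
  assumes "verts G \<noteq> {}" and "\<nexists>v. dominating_vertex G v"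
  shows "max_degree G < card (verts G) - 1"
  using ex_max_degree[OF assms(1)] max_degree_le[OF assms(1)] assms(2)
  by (metis dominating_vertex_iff le_neq_implies_less)

section \<open>Minimal forbidden graphs\<close>

text \<open>Induced subgraphs are replaced by vertex sets, and the nested quantification over
  subgraphs of subgraphs collapses: by minimality the violating subgraph is G itself.\<close>

lemma forbidden_chi_iff:
  "G \<in> forbidden_chi k \<longleftrightarrow> verts G \<noteq> {} \<and> chromatic_number G + k \<le> max_degree G \<and>
     (\<forall>A. A \<subset> verts G \<and> A \<noteq> {} \<longrightarrow>
        max_degree (G \<restriction> A) < chromatic_number (G \<restriction> A) + k)" (is "_ \<longleftrightarrow> ?R")
proof -
  have Ups: "G \<restriction> A \<in> Upsilon k \<longleftrightarrow>
      (\<forall>B. B \<subseteq> A \<and> B \<noteq> {} \<longrightarrow> max_degree (G \<restriction> B) < chromatic_number (G \<restriction> B) + k)"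
    (is "_ \<longleftrightarrow> ?U A") if A: "A \<subseteq> verts G" for A
  proof -
    interpret A: graph "G \<restriction> A" using A by (rule graph_induce)
    \<comment> \<open>The integer \<open>- 1\<close> becomes a strict inequality of naturals,
      without truncated subtraction.\<close>
    have int: "int (max_degree H) \<le> int (chromatic_number H) + int k - 1 \<longleftrightarrow>
        max_degree H < chromatic_number H + k" for H :: "('a, 'b) pre_digraph"
      by linarith
    have ind: "induced_subgraph H (G \<restriction> A) \<longleftrightarrow> (\<exists>B\<subseteq>A. H = G \<restriction> B)" for H
    proof
      assume H: "induced_subgraph H (G \<restriction> A)"
      then have sub: "verts H \<subseteq> A"
        by (auto simp: induced_subgraph_def subgraph_def)
      have "H = G \<restriction> verts H"
        using induced_subgraph_eq_induce[OF H] induce_subgraph_induce_subgraph[OF sub, of G]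
        by argo
      then show "\<exists>B\<subseteq>A. H = G \<restriction> B" using sub by blast
    next
      assume "\<exists>B\<subseteq>A. H = G \<restriction> B"
      then show "induced_subgraph H (G \<restriction> A)"
        using A.induced_induce induce_subgraph_induce_subgraph[of _ A G] by auto
    qed
    have all: "(\<forall>H. (\<exists>B\<subseteq>A. H = G \<restriction> B) \<and> verts H \<noteq> {} \<longrightarrow> P H) \<longleftrightarrow>
        (\<forall>B. B \<subseteq> A \<and> B \<noteq> {} \<longrightarrow> P (G \<restriction> B))" for P
      by (metis induce_subgraph_verts)
    show ?thesis unfolding Upsilon_def mem_Collect_eq int ind all
      using A.graph_axioms by argo
  qed
  have ind: "induced_subgraph H G \<and> H \<noteq> G \<longleftrightarrow> (\<exists>A\<subset>verts G. H = G \<restriction> A)" for H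
  proof
    assume *: "induced_subgraph H G \<and> H \<noteq> G"
    then have H: "H = G \<restriction> verts H" and "verts H \<subseteq> verts G"
      using induced_subgraph_eq_induce[of H G] by (auto simp: induced_subgraph_def subgraph_def)
    moreover have "verts H \<noteq> verts G"
    proof
      assume "verts H = verts G"
      with H have "H = G \<restriction> verts G" by argo
      then show False using * induce_subgraph_self by simp
    qed
    ultimately show "\<exists>A\<subset>verts G. H = G \<restriction> A" by blast
  next
    assume "\<exists>A\<subset>verts G. H = G \<restriction> A"
    then obtain A where "A \<subset> verts G" "H = G \<restriction> A" by blast
    moreover from this have "verts H \<noteq> verts G" by simp
    ultimately show "induced_subgraph H G \<and> H \<noteq> G"
      using induced_induce[of A] by blast
  qed
  have "G \<in> forbidden_chi k \<longleftrightarrow> \<not> ?U (verts G) \<and> (\<forall>A\<subset>verts G. ?U A)"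
  proof -
    have "G \<in> Upsilon k \<longleftrightarrow> ?U (verts G)"
      using Ups[OF subset_refl] by (simp only: induce_subgraph_self)
    moreover have "(\<forall>H. (\<exists>A\<subset>verts G. H = G \<restriction> A) \<longrightarrow> H \<in> Upsilon k) \<longleftrightarrow>
        (\<forall>A\<subset>verts G. ?U A)"
      using Ups by (metis (no_types, lifting) psubset_imp_subset)
    ultimately show ?thesis
      unfolding forbidden_chi_def mem_Collect_eq ind using graph_axioms by argo
  qed
  also have "\<dots> \<longleftrightarrow> verts G \<noteq> {} \<and>
      \<not> max_degree (G \<restriction> verts G) < chromatic_number (G \<restriction> verts G) + k \<and>
      (\<forall>A. A \<subset> verts G \<and> A \<noteq> {} \<longrightarrow>
        max_degree (G \<restriction> A) < chromatic_number (G \<restriction> A) + k)"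
  proof -
    \<comment> \<open>Pure set theory: if some nonempty subset of \<open>V\<close> is bad but none
      inside a proper subset is, then \<open>V\<close> is the bad one.\<close>
    have "\<not> (\<forall>B. B \<subseteq> V \<and> B \<noteq> {} \<longrightarrow> P B) \<and>
          (\<forall>A\<subset>V. \<forall>B. B \<subseteq> A \<and> B \<noteq> {} \<longrightarrow> P B) \<longleftrightarrow>
        V \<noteq> {} \<and> \<not> P V \<and> (\<forall>A. A \<subset> V \<and> A \<noteq> {} \<longrightarrow> P A)"
      for P and V :: "'a set"
      by (metis psubsetI subset_psubset_trans subset_refl)
    then show ?thesis .
  qed
  also have "\<dots> \<longleftrightarrow> ?R"
    by (simp only: induce_subgraph_self not_less)
  finally show ?thesis .
qed

text \<open>In the presence of a dominating vertex \<open>v\<close>, condition (2) says that no vertex other than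
  \<open>v\<close> is critical for the chromatic number of \<open>G\<close> itself.\<close>
lemma color_classes_del_dominating_iff:
  assumes v: "dominating_vertex G v"
  shows "(\<forall>c. optimal_coloring (del_vert v) c \<longrightarrow>
      (\<forall>i<chromatic_number (del_vert v). 2 \<le> card (color_class (del_vert v) c i))) \<longleftrightarrow>
    (\<forall>u\<in>verts G - {v}. chromatic_number (del_vert u) = chromatic_number G)"
proof -
  interpret V: graph "del_vert v" by (rule graph_del_vert)
  have "chromatic_number (V.del_vert u) = chromatic_number (del_vert v) \<longleftrightarrow>
      chromatic_number (del_vert u) = chromatic_number G" if u: "u \<in> verts G - {v}" for u
  proof -
    interpret U: graph "del_vert u" by (rule graph_del_vert)
    \<comment> \<open>Since \<open>v\<close> dominates both G and G - u, deleting it lowers both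
      chromatic numbers by exactly one; as the two deletions commute, the two equalities are
      equivalent.\<close>
    have "dominating_vertex (del_vert u) v"
      using v u unfolding del_vert_eq_induce
      by (intro dominating_vertex_induce) (auto simp: dominating_vertex_def)
    moreover have "U.del_vert v = V.del_vert u"
      by (rule pre_digraph.equality) (auto simp: del_vert_simps U.del_vert_simps V.del_vert_simps)
    ultimately show ?thesis
      using U.chromatic_number_del_dominating chromatic_number_del_dominating[OF v] by simp
  qed
  then show ?thesis
    unfolding V.color_classes_ge_2_iff by (simp add: del_vert_simps)
qed

lemma forbidden_chi_imp:
  assumes "G \<in> forbidden_chi k"
  shows "\<exists>v. dominating_vertex G v"
    and "dominating_vertex G v \<Longrightarrow> u \<in> verts G - {v} \<Longrightarrow>
      chromatic_number (del_vert u) = chromatic_number G"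
    and "max_degree G = chromatic_number G + k"
proof -
  have ne: "verts G \<noteq> {}" and ge: "chromatic_number G + k \<le> max_degree G"
    and min: "\<And>A. A \<subset> verts G \<Longrightarrow> A \<noteq> {} \<Longrightarrow>
      max_degree (G \<restriction> A) < chromatic_number (G \<restriction> A) + k"
    using assms unfolding forbidden_chi_iff by auto
  obtain w where w: "w \<in> verts G" "out_degree G w = max_degree G"
    using ex_max_degree[OF ne] by blast
  \<comment> \<open>The closed neighbourhood keeps the full degree of \<open>w\<close> and needs no
    more colours than G, so minimality leaves only \<open>N = verts G\<close>.\<close>
  define N where "N = insert w {u. w \<rightarrow>\<^bsub>G\<^esub> u}"
  have N: "N \<subseteq> verts G" "w \<in> N" using w neighbours_subset[of w] unfolding N_def by auto
  interpret N: graph "G \<restriction> N" using N(1) by (rule graph_induce)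
  have "out_degree (G \<restriction> N) w = max_degree G"
    unfolding w(2)[symmetric] out_degree_eq_card N.out_degree_eq_card
    by (rule arg_cong[where f = card]) (auto simp: dominates_induce_subgraph_iff N_def)
  then have "max_degree G \<le> max_degree (G \<restriction> N)"
    using N.out_degree_le_max_degree[of w] N(2) by simp
  moreover have "chromatic_number (G \<restriction> N) \<le> chromatic_number G"
    using N(1) by (intro chromatic_number_mono induced_induce)
  ultimately have "N = verts G" using min[of N] ge N by force
  then have dom: "dominating_vertex G w"
    using w unfolding dominating_vertex_def N_def by blast
  then show "\<exists>v. dominating_vertex G v" by blast
  have del: "max_degree G < chromatic_number (del_vert u) + k + 1"
    if v: "dominating_vertex G v" and u: "u \<in> verts G - {v}" for u v
  proof -
    interpret U: graph "del_vert u" by (rule graph_del_vert)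
    have "v \<in> verts G" using v dominating_vertex_def by metis
    then have "dominating_vertex (del_vert u) v"
      using v u unfolding del_vert_eq_induce by (intro dominating_vertex_induce) auto
    then have "max_degree (del_vert u) = card (verts G) - 1 - 1"
      using U.max_degree_dominating u by (simp add: del_vert_simps)
    \<comment> \<open>Two vertices are needed for the truncated
      \<open>card (verts G) - 1 - 1\<close> to be one less than the maximum degree of G.\<close>
    moreover have "2 \<le> card (verts G)"
      using card_mono[of "verts G" "{u, v}"] u \<open>v \<in> verts G\<close> by simp
    ultimately have "max_degree (del_vert u) + 1 = max_degree G"
      using max_degree_dominating[OF v] by simp
    moreover have "max_degree (del_vert u) < chromatic_number (del_vert u) + k"
      using min[of "verts G - {u}"] u \<open>v \<in> verts G\<close> unfolding del_vert_eq_induce by blast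
    ultimately show ?thesis by simp
  qed
  \<comment> \<open>\<open>ge\<close> and \<open>del\<close> give \<chi>(G) + k \<le> \<Delta>(G)
    \<le> \<chi>(G - u) + k \<le> \<chi>(G) + k, so equality holds throughout; the degree formula
    below comes from the same chain.\<close>
  show "chromatic_number (del_vert u) = chromatic_number G"
    if "dominating_vertex G v" "u \<in> verts G - {v}"
    using del[OF that] ge chromatic_number_del_vert_le[of u] by simp
  show "max_degree G = chromatic_number G + k"
  \<comment> \<open>On a single vertex there is no \<open>u\<close> to delete, but the degree is 0
    and \<open>ge\<close> suffices.\<close>
  proof (cases "verts G = {w}")
    case True
    then have "max_degree G = 0" using max_degree_dominating[OF dom] by simp
    then show ?thesis using ge by simp
  next
    case False
    then obtain u where "u \<in> verts G - {w}" using w by blast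
    then show ?thesis
      using del[OF dom] ge chromatic_number_del_vert_le[of u] by fastforce
  qed
qed

text \<open>A second dominating vertex would have to be non-critical, yet deleting a dominating
  vertex always saves a colour.\<close>

lemma forbidden_chi_unique_dominating:
  assumes "G \<in> forbidden_chi k" and "dominating_vertex G v" and "dominating_vertex G w"
  shows "v = w"
proof (rule ccontr)
  assume "v \<noteq> w"
  then have "chromatic_number (del_vert w) = chromatic_number G"
    using forbidden_chi_imp(2)[OF assms(1,2)] assms(3) by (simp add: dominating_vertex_def)
  then show False using chromatic_number_del_dominating[OF assms(3)] by simp
qed

lemma forbidden_chiI:
  assumes v: "dominating_vertex G v" and unique: "\<And>w. dominating_vertex G w \<Longrightarrow> w = v"
    and crit: "\<And>u. u \<in> verts G - {v} \<Longrightarrow> chromatic_number (del_vert u) = chromatic_number G"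
    and deg: "max_degree G = chromatic_number G + k"
  shows "G \<in> forbidden_chi k"
  unfolding forbidden_chi_iff
proof (intro conjI allI impI)
  show "verts G \<noteq> {}" using v unfolding dominating_vertex_def by blast
  show "chromatic_number G + k \<le> max_degree G" using deg by simp
  fix A assume A: "A \<subset> verts G \<and> A \<noteq> {}"
  interpret A: graph "G \<restriction> A" using A by (intro graph_induce) blast
  have G: "chromatic_number G + k = card (verts G) - 1"
    using deg max_degree_dominating[OF v] by simp
  have vG: "v \<in> verts G" using v unfolding dominating_vertex_def by blast
  have "finite A" using A finite_verts finite_subset by blast
  then have card: "0 < card A" using A by (simp add: card_gt_0_iff)
  show "max_degree (G \<restriction> A) < chromatic_number (G \<restriction> A) + k"
  \<comment> \<open>Every other proper subset misses some vertex besides \<open>v\<close>.\<close>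
  proof (cases "A = verts G - {v}")
    case True
    \<comment> \<open>A dominating vertex of G - v is also adjacent to \<open>v\<close>, hence a
      second dominating vertex of G.\<close>
    have "\<nexists>w. dominating_vertex (G \<restriction> A) w"
    proof
      assume "\<exists>w. dominating_vertex (G \<restriction> A) w"
      then obtain w where w: "dominating_vertex (G \<restriction> A) w" by blast
      then have "v \<rightarrow>\<^bsub>G\<^esub> w" using v True unfolding dominating_vertex_def by auto
      then have "w \<rightarrow>\<^bsub>G\<^esub> v" using sym_arcs arcs_ends_symmetric by metis
      then have "dominating_vertex G w"
        using w True unfolding dominating_vertex_def
        by (auto simp: dominates_induce_subgraph_iff)
      then show False using unique w True unfolding dominating_vertex_def by auto
    qed
    then have "max_degree (G \<restriction> A) < card A - 1"
      using A.max_degree_not_dominating A by simp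
    moreover have "chromatic_number G = Suc (chromatic_number (G \<restriction> A))"
      using chromatic_number_del_dominating[OF v] True by (simp add: del_vert_eq_induce)
    moreover have "card A = card (verts G) - 1" using True vG by simp
    ultimately show ?thesis using G by simp
  next
    case False
    then obtain u where u: "u \<in> verts G - {v}" "u \<notin> A" using A by blast
    interpret U: graph "del_vert u" by (rule graph_del_vert)
    have sub: "A \<subseteq> verts G - {u}" using A u by blast
    \<comment> \<open>Deleting \<open>u\<close> first is free by \<open>crit\<close>; only the
      remaining deletions may cost a colour. With \<open>G\<close> this gives \<chi> + k \<ge>
      \<open>card A\<close> on \<open>A\<close>, which exceeds \<open>card A - 1\<close> as
      \<open>A\<close> is nonempty.\<close>
    have "chromatic_number G \<le> chromatic_number (G \<restriction> A) + card (verts G - {u} - A)"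
      using U.chromatic_number_le_induce[of A] crit[OF u(1)] sub
      by (simp add: del_vert_eq_induce induce_subgraph_induce_subgraph)
    moreover have "card (verts G - {u} - A) = card (verts G) - 1 - card A"
      using sub u \<open>finite A\<close> by (simp add: card_Diff_subset)
    moreover have "max_degree (G \<restriction> A) \<le> card A - 1"
      using A.max_degree_le A by simp
    moreover have "card A \<le> card (verts G) - 1"
      using card_mono[OF _ sub] u by simp
    ultimately show ?thesis using G card by linarith
  qed
qed

end

theorem theorem2:
  fixes k :: nat and G :: "('a, 'b) pre_digraph"
  assumes "graph G"
  shows "G \<in> forbidden_chi k \<longleftrightarrow>
     (\<exists>!v. dominating_vertex G v) \<and>
     (\<forall>v. dominating_vertex G v \<longrightarrow>
        (\<forall>c. optimal_coloring (pre_digraph.del_vert G v) c \<longrightarrow>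
           (\<forall>i < chromatic_number (pre_digraph.del_vert G v).
              card (color_class (pre_digraph.del_vert G v) c i) \<ge> 2))) \<and>
     max_degree G = chromatic_number G + k"
    (is "_ \<longleftrightarrow> ?unique \<and> ?classes \<and> ?deg")
proof -
  interpret graph G by (rule assms)
  \<comment> \<open>Condition (2) is traded for non-criticality, the form in which both directions
    handle it.\<close>
  have classes: "?classes \<longleftrightarrow> (\<forall>v. dominating_vertex G v \<longrightarrow>
      (\<forall>u\<in>verts G - {v}. chromatic_number (del_vert u) = chromatic_number G))"
    using color_classes_del_dominating_iff by auto
  show ?thesis
    unfolding classes
    using forbidden_chi_imp[of k] forbidden_chi_unique_dominating[of k] forbidden_chiI[of _ k]
    by metis
qed

end
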